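(* Let $G=(V,w,m)$ be a connected, complete, locally finite weighted graph with non-degenerate vertex measure. Suppose $G$ satisfies the curvature-dimension inequality $CD(K,n)$ for some $K>0$ and some $0<n<\infty$. Then $$\operatorname{diam}_\rho(G)\le \pi\sqrt{\frac nK}.$$
   Context: A weighted graph $G=(V,w,m)$ consists of a countable set $V$, a symmetric function $w:V\times V\to[0,\infty)$ vanishing on the diagonal (edge weight), and a function $m:V\to(0,\infty)$ (vertex measure). It is locally finite if for every $x\in V$ there are only finitely many $y\in V$ with $w(x,y)>0$. It is connected if any two vertices are joined by a finite path $x_0,\dots,x_k$ with $w(x_{i-1},x_i)>0$ for all $i$. No bound on the vertex degrees is assumed. The Laplacian is $\Delta f(x)=\frac1{m(x)}\sum_y w(x,y)(f(y)-f(x))$ for $f:V\to\mathbb R$. For $f,g:V\to\mathbb R$ define $2\Gamma(f,g)=\Delta(fg)-f\Delta g-g\Delta f$ and $2\Gamma_2(f,g)=\Delta\Gamma(f,g)-\Gamma(f,\Delta g)-\Gamma(g,\Delta f)$, and write $\Gamma f=\Gamma(f,f)$, $\Gamma_2(f)=\Gamma_2(f,f)$. For $K\in\mathbb R$ and $n\in(0,\infty]$, $G$ satisfies $CD(K,n)$ if $\Gamma_2(f)\ge\frac1n(\Delta f)^2+K\,\Gamma f$ pointwise on $V$ for all $f:V\to\mathbb R$. The graph is complete if there is a nondecreasing sequence $(\eta_k)_{k\ge1}$ of finitely supported functions $V\to\mathbb R$ with $\eta_k\to1$ pointwise and $\Gamma\eta_k\le\frac1k$ on $V$ for all $k$. (This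 is not the notion of complete graph from combinatorics.) The vertex measure is non-degenerate if $\inf_{x\in V}m(x)>0$. The resistance metric is $\rho(x,y)=\sup\{f(y)-f(x): f:V\to\mathbb R,\ \|\Gamma f\|_\infty\le1\}$, where $\|\cdot\|_\infty$ is the supremum norm, and $\operatorname{diam}_\rho(G)=\sup_{x,y\in V}\rho(x,y)$. *)

theory Defs
  imports "HOL-Analysis.Analysis"
begin

text \<open>The vertex set is the whole type \<open>'v\<close>; a weighted graph is given by the edge weight \<open>w\<close> and
  the vertex measure \<open>m\<close>.\<close>

definition weighted_graph :: "('v \<Rightarrow> 'v \<Rightarrow> real) \<Rightarrow> ('v \<Rightarrow> real) \<Rightarrow> bool" where
  "weighted_graph w m \<longleftrightarrow>
     countable (UNIV :: 'v set) \<and>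
     (\<forall>x y. 0 \<le> w x y) \<and> (\<forall>x y. w x y = w y x) \<and> (\<forall>x. w x x = 0) \<and> (\<forall>x. 0 < m x)"

definition locally_finite_graph :: "('v \<Rightarrow> 'v \<Rightarrow> real) \<Rightarrow> bool" where
  "locally_finite_graph w \<longleftrightarrow> (\<forall>x. finite {y. 0 < w x y})"

definition connected_graph :: "('v \<Rightarrow> 'v \<Rightarrow> real) \<Rightarrow> bool" where
  "connected_graph w \<longleftrightarrow> (\<forall>x y. (\<lambda>u v. 0 < w u v)\<^sup>*\<^sup>* x y)"

text \<open>On a locally finite graph the sum has finitely many nonzero terms, so it converges for
  every \<open>f\<close>.\<close>

definition laplacian :: "('v \<Rightarrow> 'v \<Rightarrow> real) \<Rightarrow> ('v \<Rightarrow> real) \<Rightarrow> ('v \<Rightarrow> real) \<Rightarrow> 'v \<Rightarrow> real" where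
  "laplacian w m f x = 1 / m x * (\<Sum>\<^sub>\<infinity>y. w x y * (f y - f x))"

definition Gamma_form ::
  "('v \<Rightarrow> 'v \<Rightarrow> real) \<Rightarrow> ('v \<Rightarrow> real) \<Rightarrow> ('v \<Rightarrow> real) \<Rightarrow> ('v \<Rightarrow> real) \<Rightarrow> 'v \<Rightarrow> real" where
  "Gamma_form w m f g x =
     (laplacian w m (\<lambda>z. f z * g z) x - f x * laplacian w m g x - g x * laplacian w m f x) / 2"

definition Gamma2_form ::
  "('v \<Rightarrow> 'v \<Rightarrow> real) \<Rightarrow> ('v \<Rightarrow> real) \<Rightarrow> ('v \<Rightarrow> real) \<Rightarrow> ('v \<Rightarrow> real) \<Rightarrow> 'v \<Rightarrow> real" where
  "Gamma2_form w m f g x =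
     (laplacian w m (Gamma_form w m f g) x
        - Gamma_form w m f (laplacian w m g) x
        - Gamma_form w m g (laplacian w m f) x) / 2"

text \<open>The dimension \<open>n\<close> ranges over \<open>(0, \<infinity>]\<close>; for \<open>n = \<infinity>\<close> the coefficient \<open>1 / n\<close> is \<open>0\<close>.\<close>

definition CD :: "('v \<Rightarrow> 'v \<Rightarrow> real) \<Rightarrow> ('v \<Rightarrow> real) \<Rightarrow> real \<Rightarrow> ereal \<Rightarrow> bool" where
  "CD w m K n \<longleftrightarrow>
     (\<forall>f x. Gamma2_form w m f f x
              \<ge> real_of_ereal (1 / n) * (laplacian w m f x)\<^sup>2 + K * Gamma_form w m f f x)"

text \<open>Completeness in the sense of cutoff functions; unrelated to complete graphs in
  combinatorics.\<close>

definition complete_graph :: "('v \<Rightarrow> 'v \<Rightarrow> real) \<Rightarrow> ('v \<Rightarrow> real) \<Rightarrow> bool" where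
  "complete_graph w m \<longleftrightarrow>
     (\<exists>\<eta> :: nat \<Rightarrow> 'v \<Rightarrow> real.
        mono_on {1..} \<eta> \<and>
        (\<forall>k\<ge>1. finite {x. \<eta> k x \<noteq> 0}) \<and>
        (\<forall>x. (\<lambda>k. \<eta> k x) \<longlonglongrightarrow> 1) \<and>
        (\<forall>k\<ge>1. \<forall>x. Gamma_form w m (\<eta> k) (\<eta> k) x \<le> 1 / real k))"

text \<open>For \<open>m\<close> positive, the infimum below is that of a nonempty set bounded below by \<open>0\<close>.\<close>

definition nondegenerate_measure :: "('v \<Rightarrow> real) \<Rightarrow> bool" where
  "nondegenerate_measure m \<longleftrightarrow> 0 < (INF x. m x)"

definition sup_norm :: "('v \<Rightarrow> real) \<Rightarrow> ereal" where
  "sup_norm f = (SUP x. ereal \<bar>f x\<bar>)"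

definition resistance_metric ::
  "('v \<Rightarrow> 'v \<Rightarrow> real) \<Rightarrow> ('v \<Rightarrow> real) \<Rightarrow> 'v \<Rightarrow> 'v \<Rightarrow> ereal" where
  "resistance_metric w m x y =
     (SUP f \<in> {f. sup_norm (Gamma_form w m f f) \<le> 1}. ereal (f y - f x))"

definition resistance_diameter :: "('v \<Rightarrow> 'v \<Rightarrow> real) \<Rightarrow> ('v \<Rightarrow> real) \<Rightarrow> ereal" where
  "resistance_diameter w m = (SUP x. SUP y. resistance_metric w m x y)"

end

theory Submission
  imports Defs
begin

text \<open>For finitely supported \<open>f\<close> with \<open>\<Gamma> f \<le> 1\<close>, run the implicit Euler scheme
  \<open>g\<^sub>k = g\<^sub>k\<^sub>+\<^sub>1 - h \<Delta> g\<^sub>k\<^sub>+\<^sub>1\<close>, \<open>g\<^sub>0 = f\<close>, for the heat equation in \<open>\<ell>\<^sup>2(V, m)\<close>. The function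
  \<open>H\<^sub>k = \<Gamma> g\<^sub>k + \<phi>\<^sub>k (\<Delta> g\<^sub>k)\<^sup>2\<close> is \<open>m\<close>-summable, hence attains its maximum since \<open>inf m > 0\<close>, and the
  maximum principle together with \<open>CD(K, n)\<close> gives \<open>max H\<^sub>k \<le> q\<^sup>k max H\<^sub>0\<close> with \<open>q = 1 / (1 + 2 h K)\<close>
  and \<open>\<phi>\<^sub>k\<close> roughly \<open>(1 - q\<^sup>k) / (n K)\<close>. Thus \<open>|\<Delta> g\<^sub>k|\<close> is bounded by \<open>sqrt (n K) tan \<theta>\<^sub>k\<close> where
  \<open>sin\<^sup>2 \<theta>\<^sub>k = q\<^sup>k\<close>, and summing the increments \<open>h \<Delta> g\<^sub>k\<close> bounds \<open>|g\<^sub>N - f|\<close> by about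
  \<open>(\<pi> / 2) sqrt (n / K)\<close> uniformly in \<open>N\<close>. As \<open>\<Gamma> g\<^sub>N \<rightarrow> 0\<close>, the function \<open>g\<^sub>N\<close> becomes constant along
  any finite path, so \<open>f\<close> oscillates by at most \<open>\<pi> sqrt (n / K)\<close>. Completeness is needed only to cut
  off a general \<open>f\<close>.\<close>

text \<open>With \<open>\<alpha> = \<beta> + d\<close>, the addition formula,
  \<open>cos d \<le> 1\<close> and \<open>sin d \<le> d\<close> give
  \<open>sin \<alpha> \<le> sin \<beta> + d * cos \<beta>\<close>; the quotient on the left is the
  tangent of \<open>\<beta>\<close>. When \<open>s\<close> and \<open>p * s\<close> are consecutive
  terms of a geometric sequence, the right-hand sides telescope.\<close>

lemma arcsin_step:
  fixes s p :: real
  assumes "0 < s" "1 < p" "p * s \<le> 1"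
  shows "(p - 1) * (s / sqrt (1 - s\<^sup>2)) \<le> arcsin (p * s) - arcsin s"
proof -
  define \<alpha> where "\<alpha> = arcsin (p * s)"
  define \<beta> where "\<beta> = arcsin s"
  have ps: "s < p * s" using assms by simp
  then have s: "-1 \<le> s" "s < 1" "-1 \<le> p * s" using assms by linarith+
  have sin: "sin \<alpha> = p * s" "sin \<beta> = s"
    unfolding \<alpha>_def \<beta>_def using s assms by (auto intro!: sin_arcsin)
  have cos: "cos \<beta> = sqrt (1 - s\<^sup>2)"
    unfolding \<beta>_def using s by (intro cos_arcsin) auto
  have "s\<^sup>2 < 1"
    using s assms by (simp add: abs_square_less_1)
  then have cos_pos: "0 < cos \<beta>" unfolding cos by simp
  have d: "0 \<le> \<alpha> - \<beta>"
    unfolding \<alpha>_def \<beta>_def using s ps assms by (simp add: arcsin_le_arcsin)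
  have "sin \<alpha> = sin \<beta> * cos (\<alpha> - \<beta>) + cos \<beta> * sin (\<alpha> - \<beta>)"
    using sin_add[of \<beta> "\<alpha> - \<beta>"] by simp
  also have "\<dots> \<le> sin \<beta> * 1 + cos \<beta> * (\<alpha> - \<beta>)"
    using d cos_pos assms sin by (intro add_mono mult_left_mono sin_x_le_x cos_le_one) auto
  finally have "(p - 1) * s \<le> (\<alpha> - \<beta>) * cos \<beta>"
    unfolding sin by (simp add: algebra_simps)
  then show ?thesis
    using cos_pos unfolding \<alpha>_def[symmetric] \<beta>_def[symmetric] cos[symmetric]
    by (simp add: field_simps)
qed

section \<open>Finite-sum formulas for \<open>\<Delta>\<close> and \<open>\<Gamma>\<close> on a
  locally finite graph\<close>

locale lf_graph =
  fixes w :: "'v \<Rightarrow> 'v \<Rightarrow> real" and m :: "'v \<Rightarrow> real"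
  assumes weighted: "weighted_graph w m"
    and locally_finite: "locally_finite_graph w"
begin

abbreviation "\<Delta> \<equiv> laplacian w m"
abbreviation "\<Gamma> \<equiv> Gamma_form w m"

definition nbrs :: "'v \<Rightarrow> 'v set" where
  "nbrs x = {y. 0 < w x y}"

lemma w_nonneg: "0 \<le> w x y" and w_sym: "w x y = w y x" and m_pos: "0 < m x"
  and countable_vertices: "countable (UNIV :: 'v set)"
  using weighted unfolding weighted_graph_def by auto

lemma finite_nbrs: "finite (nbrs x)"
  using locally_finite unfolding locally_finite_graph_def nbrs_def by auto

lemma not_nbr: "y \<notin> nbrs x \<Longrightarrow> w x y = 0"
  using w_nonneg[of x y] unfolding nbrs_def by auto

lemma laplacian_sum: "\<Delta> f x = (\<Sum>y\<in>nbrs x. w x y * (f y - f x)) / m x"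
proof -
  have "(\<Sum>\<^sub>\<infinity>y. w x y * (f y - f x)) = (\<Sum>\<^sub>\<infinity>y\<in>nbrs x. w x y * (f y - f x))"
    by (rule infsum_cong_neutral) (auto simp: not_nbr)
  then show ?thesis
    by (simp add: laplacian_def finite_nbrs)
qed

lemma laplacian_add: "\<Delta> (\<lambda>z. f z + g z) x = \<Delta> f x + \<Delta> g x"
  by (simp add: laplacian_sum algebra_simps sum.distrib sum_subtractf add_divide_distrib
      diff_divide_distrib)

lemma laplacian_cmult: "\<Delta> (\<lambda>z. c * f z) x = c * \<Delta> f x"
proof -
  have "(\<Sum>y\<in>nbrs x. w x y * (c * f y - c * f x)) = c * (\<Sum>y\<in>nbrs x. w x y * (f y - f x))"
    unfolding sum_distrib_left by (rule sum.cong) (auto simp: algebra_simps)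
  then show ?thesis
    by (simp add: laplacian_sum)
qed

lemma laplacian_diff: "\<Delta> (\<lambda>z. f z - g z) x = \<Delta> f x - \<Delta> g x"
  using laplacian_add[of f "\<lambda>z. - 1 * g z" x] laplacian_cmult[of "-1" g x] by simp

lemma Gamma_sum:
  "\<Gamma> f g x = (\<Sum>y\<in>nbrs x. w x y * ((f y - f x) * (g y - g x))) / (2 * m x)"
proof -
  have "(\<Sum>y\<in>nbrs x. w x y * ((f y - f x) * (g y - g x))) =
    (\<Sum>y\<in>nbrs x. w x y * (f y * g y - f x * g x)) - f x * (\<Sum>y\<in>nbrs x. w x y * (g y - g x))
      - g x * (\<Sum>y\<in>nbrs x. w x y * (f y - f x))"
    unfolding sum_distrib_left sum_subtractf[symmetric]
    by (rule sum.cong) (auto simp: algebra_simps)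
  then show ?thesis
    by (simp add: Gamma_form_def laplacian_sum diff_divide_distrib)
qed

lemma Gamma_nonneg: "0 \<le> \<Gamma> f f x"
  using m_pos[of x] unfolding Gamma_sum
  by (intro divide_nonneg_pos sum_nonneg mult_nonneg_nonneg w_nonneg zero_le_square) simp

lemma Gamma_edge: "w x y * (f y - f x)\<^sup>2 \<le> 2 * m x * \<Gamma> f f x"
proof (cases "y \<in> nbrs x")
  case True
  have "w x y * ((f y - f x) * (f y - f x)) \<le> (\<Sum>y\<in>nbrs x. w x y * ((f y - f x) * (f y - f x)))"
    by (rule member_le_sum[OF True]) (intro mult_nonneg_nonneg w_nonneg zero_le_square finite_nbrs)+
  then show ?thesis
    using m_pos[of x] by (simp add: Gamma_sum power2_eq_square)
next
  case False
  then show ?thesis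
    using Gamma_nonneg[of f x] m_pos[of x] by (simp add: not_nbr)
qed

text \<open>Meant for truncations, which contract differences.\<close>

lemma Gamma_mono:
  assumes "\<And>y. \<bar>f y - f x\<bar> \<le> \<bar>g y - g x\<bar>"
  shows "\<Gamma> f f x \<le> \<Gamma> g g x"
proof -
  have "(f y - f x) * (f y - f x) \<le> (g y - g x) * (g y - g x)" for y
    using assms[of y] by (metis abs_le_square_iff power2_eq_square)
  then show ?thesis
    unfolding Gamma_sum using m_pos[of x]
    by (auto intro!: divide_right_mono sum_mono mult_left_mono w_nonneg)
qed

lemma Gamma_cmult: "\<Gamma> (\<lambda>z. c * f z) (\<lambda>z. c * f z) x = c\<^sup>2 * \<Gamma> f f x"
proof -
  have "(\<Sum>y\<in>nbrs x. w x y * ((c * f y - c * f x) * (c * f y - c * f x))) =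
    c\<^sup>2 * (\<Sum>y\<in>nbrs x. w x y * ((f y - f x) * (f y - f x)))"
    unfolding sum_distrib_left by (rule sum.cong) (auto simp: algebra_simps power2_eq_square)
  then show ?thesis
    by (simp add: Gamma_sum)
qed

lemma Gamma_sub_scaled:
  "\<Gamma> (\<lambda>z. g z - h * v z) (\<lambda>z. g z - h * v z) x = \<Gamma> g g x - 2 * h * \<Gamma> g v x + h\<^sup>2 * \<Gamma> v v x"
proof -
  have "(\<Sum>y\<in>nbrs x. w x y * ((g y - h * v y - (g x - h * v x)) * (g y - h * v y - (g x - h * v x)))) =
     (\<Sum>y\<in>nbrs x. w x y * ((g y - g x) * (g y - g x)))
     - 2 * h * (\<Sum>y\<in>nbrs x. w x y * ((g y - g x) * (v y - v x)))
     + h\<^sup>2 * (\<Sum>y\<in>nbrs x. w x y * ((v y - v x) * (v y - v x)))"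
    unfolding sum_distrib_left sum_subtractf[symmetric] sum.distrib[symmetric]
    by (rule sum.cong) (auto simp: algebra_simps power2_eq_square)
  then show ?thesis
    by (simp add: Gamma_sum diff_divide_distrib add_divide_distrib)
qed

text \<open>The parallelogram identity for \<open>\<Gamma>\<close>, with the nonnegative term of
  \<open>f + g\<close> dropped.\<close>

lemma Gamma_diff_le:
  "\<Gamma> (\<lambda>z. f z - g z) (\<lambda>z. f z - g z) x \<le> 2 * \<Gamma> f f x + 2 * \<Gamma> g g x"
  using Gamma_sub_scaled[of f 1 g x] Gamma_sub_scaled[of f "-1" g x]
    Gamma_nonneg[of "\<lambda>z. f z - (-1) * g z" x] by simp

lemma laplacian_square: "\<Delta> (\<lambda>z. (v z)\<^sup>2) x = 2 * v x * \<Delta> v x + 2 * \<Gamma> v v x"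
  by (simp add: Gamma_form_def power2_eq_square field_simps)

section \<open>Maximum principle for one implicit Euler step\<close>

lemma laplacian_nonpos_at_max:
  assumes "\<And>y. f y \<le> f x"
  shows "\<Delta> f x \<le> 0"
  unfolding laplacian_sum using assms m_pos[of x]
  by (auto intro!: divide_nonpos_pos sum_nonpos mult_nonneg_nonpos w_nonneg)

text \<open>At a maximum of \<open>\<Gamma> g + \<phi>' (\<Delta> g)\<^sup>2\<close>, the term \<open>2 h (\<phi>' - \<phi>) v \<Delta> v\<close> created by the mismatch of
  \<open>\<phi>\<close> and \<open>\<phi>'\<close> is absorbed by \<open>\<phi> h\<^sup>2 (\<Delta> v)\<^sup>2\<close>, where \<open>v = \<Delta> g\<close>.\<close>

lemma euler_step_at_max:
  assumes CD: "CD w m K (ereal n)" and n: "0 < n" and h: "0 < h" and \<phi>: "0 < \<phi>" "\<phi> \<le> \<phi>'"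
    and cond: "(1 + 2 * h * K) * \<phi>' + (\<phi>' - \<phi>)\<^sup>2 / \<phi> \<le> 2 * h / n + \<phi>"
    and step: "\<And>z. f z = g z - h * \<Delta> g z"
    and max: "\<And>y. \<Gamma> g g y + \<phi>' * (\<Delta> g y)\<^sup>2 \<le> \<Gamma> g g x + \<phi>' * (\<Delta> g x)\<^sup>2"
  shows "(1 + 2 * h * K) * (\<Gamma> g g x + \<phi>' * (\<Delta> g x)\<^sup>2) \<le> \<Gamma> f f x + \<phi> * (\<Delta> f x)\<^sup>2"
proof -
  define v where "v = \<Delta> g"
  have f: "f = (\<lambda>z. g z - h * v z)"
    using step by (auto simp: v_def)
  have lap_f: "\<Delta> f x = v x - h * \<Delta> v x"
    unfolding f by (simp add: laplacian_diff laplacian_cmult v_def)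
  have G: "\<Gamma> f f x \<ge> \<Gamma> g g x - 2 * h * \<Gamma> g v x"
    unfolding f Gamma_sub_scaled using Gamma_nonneg[of v x] by simp
  have "real_of_ereal (1 / ereal n) = 1 / n"
    using n by (simp add: one_ereal_def)
  then have "Gamma2_form w m g g x \<ge> 1 / n * (v x)\<^sup>2 + K * \<Gamma> g g x"
    using CD unfolding CD_def v_def by metis
  then have "2 * h * (1 / n * (v x)\<^sup>2 + K * \<Gamma> g g x) \<le> 2 * h * Gamma2_form w m g g x"
    using h by (intro mult_left_mono) auto
  also have "\<dots> = h * \<Delta> (\<Gamma> g g) x - 2 * h * \<Gamma> g v x"
    unfolding Gamma2_form_def v_def by (simp add: field_simps)
  \<comment> \<open>The cross term is the first-order part of
    \<open>\<Gamma> f f x - \<Gamma> g g x\<close>. Curvature exchanges it for a gain and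
    \<open>h * \<Delta> (\<Gamma> g g) x\<close>, which the maximum property bounds next.\<close>
  finally have G2: "- 2 * h * \<Gamma> g v x \<ge> 2 * h / n * (v x)\<^sup>2 + 2 * h * K * \<Gamma> g g x - h * \<Delta> (\<Gamma> g g) x"
    by (simp add: algebra_simps)
  have "\<Delta> (\<lambda>y. \<Gamma> g g y + \<phi>' * (v y)\<^sup>2) x \<le> 0"
    by (rule laplacian_nonpos_at_max) (use max v_def in auto)
  then have "\<Delta> (\<Gamma> g g) x + \<phi>' * (2 * v x * \<Delta> v x + 2 * \<Gamma> v v x) \<le> 0"
    by (simp only: laplacian_add laplacian_cmult laplacian_square)
  moreover have "0 \<le> \<phi>' * (2 * \<Gamma> v v x)"
    using \<phi> Gamma_nonneg[of v x] by simp
  ultimately have "\<Delta> (\<Gamma> g g) x \<le> - (2 * \<phi>' * (v x * \<Delta> v x))"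
    by (simp add: algebra_simps)
  then have M: "h * \<Delta> (\<Gamma> g g) x \<le> h * - (2 * \<phi>' * (v x * \<Delta> v x))"
    using h by (intro mult_left_mono) auto
  have "0 \<le> (\<phi> * h * \<Delta> v x + (\<phi>' - \<phi>) * v x)\<^sup>2 / \<phi>"
    using \<phi> by simp
  also have "\<dots> = \<phi> * h\<^sup>2 * (\<Delta> v x)\<^sup>2 + 2 * h * (\<phi>' - \<phi>) * (v x * \<Delta> v x) + (\<phi>' - \<phi>)\<^sup>2 / \<phi> * (v x)\<^sup>2"
    using \<phi> by (simp add: field_simps power2_eq_square)
  finally have Q: "\<phi> * h\<^sup>2 * (\<Delta> v x)\<^sup>2 + 2 * h * (\<phi>' - \<phi>) * (v x * \<Delta> v x) + (\<phi>' - \<phi>)\<^sup>2 / \<phi> * (v x)\<^sup>2 \<ge> 0" .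
  have C: "((1 + 2 * h * K) * \<phi>' + (\<phi>' - \<phi>)\<^sup>2 / \<phi>) * (v x)\<^sup>2 \<le> (2 * h / n + \<phi>) * (v x)\<^sup>2"
    by (rule mult_right_mono[OF cond]) simp
  have L: "\<phi> * (\<Delta> f x)\<^sup>2 = \<phi> * (v x)\<^sup>2 - 2 * h * \<phi> * (v x * \<Delta> v x) + \<phi> * h\<^sup>2 * (\<Delta> v x)\<^sup>2"
    unfolding lap_f by (simp add: algebra_simps power2_eq_square)
  show ?thesis
    using G G2 M Q C unfolding L v_def[symmetric] by (simp add: algebra_simps)
qed

section \<open>Summable nonnegative functions and attained maxima\<close>

text \<open>Only meaningful for \<open>u \<ge> 0\<close>, where it says that \<open>u\<close> lies in \<open>\<ell>\<^sup>1(V, m)\<close>.\<close>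

definition ell1 :: "('v \<Rightarrow> real) \<Rightarrow> bool" where
  "ell1 u \<longleftrightarrow> (\<exists>C. \<forall>F. finite F \<longrightarrow> (\<Sum>x\<in>F. m x * u x) \<le> C)"

lemma ell1_add:
  assumes "ell1 u" "ell1 v"
  shows "ell1 (\<lambda>x. u x + v x)"
proof -
  obtain C D where CD: "\<And>F. finite F \<Longrightarrow> (\<Sum>x\<in>F. m x * u x) \<le> C" "\<And>F. finite F \<Longrightarrow> (\<Sum>x\<in>F. m x * v x) \<le> D"
    using assms unfolding ell1_def by blast
  have "(\<Sum>x\<in>F. m x * (u x + v x)) \<le> C + D" if "finite F" for F
    unfolding distrib_left sum.distrib by (intro add_mono CD that)
  then show ?thesis
    unfolding ell1_def by blast
qed

lemma ell1_cmult:
  assumes "ell1 u" "0 \<le> c"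
  shows "ell1 (\<lambda>x. c * u x)"
proof -
  obtain C where C: "\<And>F. finite F \<Longrightarrow> (\<Sum>x\<in>F. m x * u x) \<le> C"
    using assms unfolding ell1_def by blast
  have "(\<Sum>x\<in>F. m x * (c * u x)) \<le> c * C" if "finite F" for F
    unfolding mult.left_commute[of _ c] sum_distrib_left[symmetric]
    by (intro mult_left_mono C that assms)
  then show ?thesis
    unfolding ell1_def by blast
qed

lemma ell1_mono:
  assumes "ell1 v" "\<And>x. u x \<le> v x"
  shows "ell1 u"
proof -
  obtain C where C: "\<And>F. finite F \<Longrightarrow> (\<Sum>x\<in>F. m x * v x) \<le> C"
    using assms unfolding ell1_def by blast
  have "(\<Sum>x\<in>F. m x * u x) \<le> C" if "finite F" for F
    using C[OF that] sum_mono[of F "\<lambda>x. m x * u x" "\<lambda>x. m x * v x"] assms(2) m_pos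
    by (simp add: mult_left_mono less_imp_le order_trans)
  then show ?thesis
    unfolding ell1_def by blast
qed

lemma ell1_finite_support:
  assumes "finite {x. u x \<noteq> 0}"
  shows "ell1 u"
proof -
  have "(\<Sum>x\<in>F. m x * u x) \<le> (\<Sum>x\<in>{x. u x \<noteq> 0}. m x * \<bar>u x\<bar>)" if F: "finite F" for F
  proof -
    have "(\<Sum>x\<in>F. m x * u x) \<le> (\<Sum>x\<in>F. m x * \<bar>u x\<bar>)"
      by (intro sum_mono mult_left_mono) (auto simp: m_pos less_imp_le)
    also have "\<dots> \<le> (\<Sum>x\<in>F \<union> {x. u x \<noteq> 0}. m x * \<bar>u x\<bar>)"
      using F assms by (intro sum_mono2) (auto simp: m_pos less_imp_le)
    also have "\<dots> = (\<Sum>x\<in>{x. u x \<noteq> 0}. m x * \<bar>u x\<bar>)"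
      using F assms by (intro sum.mono_neutral_right) auto
    finally show ?thesis .
  qed
  then show ?thesis
    unfolding ell1_def by blast
qed

text \<open>Each vertex with \<open>u x \<ge> u x0 > 0\<close> adds at least
  \<open>\<mu> * u x0\<close> to sums bounded by \<open>C\<close>, so there are finitely many of
  them, and the largest value among them is the global maximum.\<close>

lemma ell1_attains_max:
  assumes nd: "nondegenerate_measure m" and u: "ell1 u" "\<And>x. 0 \<le> u x"
  obtains x where "\<And>y. u y \<le> u x"
proof (cases "\<forall>x. u x = 0")
  case True
  then show ?thesis using that by simp
next
  case False
  then obtain x0 where x0: "0 < u x0"
    using u(2) by (metis order_le_less)
  define \<mu> where "\<mu> = (INF x. m x)"
  have \<mu>: "0 < \<mu>"
    using nd unfolding nondegenerate_measure_def \<mu>_def .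
  have bdd: "bdd_below (range m)"
    by (rule bdd_belowI[of _ 0]) (auto simp: m_pos less_imp_le)
  have \<mu>_le: "\<mu> \<le> m x" for x
    unfolding \<mu>_def by (rule cINF_lower[OF bdd]) simp
  obtain C where C: "\<And>F. finite F \<Longrightarrow> (\<Sum>x\<in>F. m x * u x) \<le> C"
    using u(1) unfolding ell1_def by blast
  define A where "A = {x. u x0 \<le> u x}"
  have card: "card F \<le> nat \<lceil>C / (\<mu> * u x0)\<rceil>" if F: "finite F" "F \<subseteq> A" for F
  proof -
    have "real (card F) * (\<mu> * u x0) = (\<Sum>x\<in>F. \<mu> * u x0)"
      by simp
    also have "\<dots> \<le> (\<Sum>x\<in>F. m x * u x)"
      using F x0 \<mu> \<mu>_le by (intro sum_mono mult_mono) (auto simp: A_def m_pos less_imp_le)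
    also have "\<dots> \<le> C" by (rule C) fact
    finally have "real (card F) \<le> C / (\<mu> * u x0)"
      using \<mu> x0 by (simp add: field_simps)
    then show ?thesis by linarith
  qed
  have A: "finite A"
    using finite_if_finite_subsets_card_bdd[of A] card by blast
  have "x0 \<in> A" by (simp add: A_def)
  then have "Max (u ` A) \<in> u ` A"
    using A by (intro Max_in) auto
  then obtain x where x: "x \<in> A" "u x = Max (u ` A)"
    by auto
  have "u y \<le> u x" for y
  proof (cases "y \<in> A")
    case True
    then show ?thesis using A x by simp
  next
    case False
    moreover have "u x0 \<le> u x" using x(1) by (simp add: A_def)
    ultimately show ?thesis by (simp add: A_def)
  qed
  then show ?thesis using that by blast
qed

section \<open>Summation by parts and energy estimates\<close>

text \<open>\<open>F\<close> contains the support together with its neighbours, so no boundary term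
  arises, and the remaining double sum over \<open>F\<close> cancels by symmetry of
  \<open>w\<close>.\<close>

lemma sum_laplacian_zero:
  assumes F: "finite F" "\<And>x. u x \<noteq> 0 \<Longrightarrow> x \<in> F \<and> nbrs x \<subseteq> F"
  shows "(\<Sum>x\<in>F. m x * \<Delta> u x) = 0"
proof -
  have "m x * \<Delta> u x = (\<Sum>y\<in>F. w x y * (u y - u x))" if "x \<in> F" for x
  proof -
    have "m x * \<Delta> u x = (\<Sum>y\<in>nbrs x. w x y * (u y - u x))"
      using m_pos[of x] by (simp add: laplacian_sum)
    also have "\<dots> = (\<Sum>y\<in>nbrs x \<union> F. w x y * (u y - u x))"
      using F finite_nbrs by (intro sum.mono_neutral_left) (auto simp: not_nbr)
    also have "\<dots> = (\<Sum>y\<in>F. w x y * (u y - u x))"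
    proof (rule sum.mono_neutral_right)
      \<comment> \<open>A neighbour \<open>y\<close> outside \<open>F\<close> has
        \<open>u y = 0\<close>, and its existence forces \<open>u x = 0\<close>, since otherwise
        \<open>nbrs x\<close> would lie in \<open>F\<close>.\<close>
      show "\<forall>y\<in>nbrs x \<union> F - F. w x y * (u y - u x) = 0"
        using F(2)[of x] F(2) by fastforce
    qed (use F finite_nbrs in auto)
    finally show ?thesis .
  qed
  then have "(\<Sum>x\<in>F. m x * \<Delta> u x) = (\<Sum>x\<in>F. \<Sum>y\<in>F. w x y * (u y - u x))"
    by simp
  also have "\<dots> = (\<Sum>x\<in>F. \<Sum>y\<in>F. w x y * u y) - (\<Sum>x\<in>F. \<Sum>y\<in>F. w x y * u x)"
    by (simp add: right_diff_distrib sum_subtractf)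
  also have "(\<Sum>x\<in>F. \<Sum>y\<in>F. w x y * u y) = (\<Sum>y\<in>F. \<Sum>x\<in>F. w x y * u y)"
    by (rule sum.swap)
  also have "\<dots> = (\<Sum>x\<in>F. \<Sum>y\<in>F. w x y * u x)"
    by (simp add: w_sym)
  finally show ?thesis by simp
qed

lemma finite_support_hull:
  assumes "finite {x. u x \<noteq> 0}" "finite E"
  obtains F where "finite F" "E \<subseteq> F" "\<And>x. u x \<noteq> 0 \<Longrightarrow> x \<in> F \<and> nbrs x \<subseteq> F"
proof
  show "finite (E \<union> {x. u x \<noteq> 0} \<union> (\<Union>x\<in>{x. u x \<noteq> 0}. nbrs x))"
    using assms finite_nbrs by auto
qed auto

text \<open>Multiply the subsolution inequality by \<open>m x * u x\<close> and sum:
  \<open>laplacian_square\<close> splits \<open>u * \<Delta> u\<close> into half the Laplacian of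
  the square, which sums to zero, minus \<open>\<Gamma> u u\<close>. The bounds do not depend on the
  support of \<open>u\<close>, so they pass to pointwise limits.\<close>

lemma subsolution_energy_bound:
  assumes u: "finite {x. u x \<noteq> 0}" "\<And>x. 0 \<le> u x" and h: "0 < h"
    and sub: "\<And>x. u x - h * \<Delta> u x \<le> f x"
    and C: "\<And>F. finite F \<Longrightarrow> (\<Sum>x\<in>F. m x * (f x)\<^sup>2) \<le> C"
    and E: "finite E"
  shows "(\<Sum>x\<in>E. m x * (u x)\<^sup>2) \<le> C" and "(\<Sum>x\<in>E. m x * \<Gamma> u u x) \<le> C / (2 * h)"
proof -
  obtain F where F: "finite F" "E \<subseteq> F" "\<And>x. u x \<noteq> 0 \<Longrightarrow> x \<in> F \<and> nbrs x \<subseteq> F"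
    using finite_support_hull[OF u(1) E] by blast
  have pt: "m x * (u x)\<^sup>2 + 2 * h * (m x * \<Gamma> u u x) - h * (m x * \<Delta> (\<lambda>z. (u z)\<^sup>2) x) \<le> m x * (f x)\<^sup>2" for x
  proof -
    have "u x * (u x - h * \<Delta> u x) \<le> u x * f x"
      by (intro mult_left_mono sub u)
    moreover have "2 * (u x * f x) \<le> (u x)\<^sup>2 + (f x)\<^sup>2"
      using sum_squares_bound[of "u x" "f x"] by simp
    ultimately have "(u x)\<^sup>2 - 2 * h * (u x * \<Delta> u x) \<le> (f x)\<^sup>2"
      by (simp add: algebra_simps power2_eq_square)
    then have "m x * ((u x)\<^sup>2 + 2 * h * \<Gamma> u u x - h * \<Delta> (\<lambda>z. (u z)\<^sup>2) x) \<le> m x * (f x)\<^sup>2"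
      using m_pos[of x] unfolding laplacian_square by (intro mult_left_mono) (auto simp: algebra_simps)
    then show ?thesis by (simp add: algebra_simps)
  qed
  have "(\<Sum>x\<in>F. m x * (u x)\<^sup>2 + 2 * h * (m x * \<Gamma> u u x) - h * (m x * \<Delta> (\<lambda>z. (u z)\<^sup>2) x))
      \<le> (\<Sum>x\<in>F. m x * (f x)\<^sup>2)"
    by (rule sum_mono) (rule pt)
  also have "\<dots> \<le> C" by (rule C) fact
  finally have "(\<Sum>x\<in>F. m x * (u x)\<^sup>2) + 2 * h * (\<Sum>x\<in>F. m x * \<Gamma> u u x)
      - h * (\<Sum>x\<in>F. m x * \<Delta> (\<lambda>z. (u z)\<^sup>2) x) \<le> C"
    by (simp add: sum.distrib sum_subtractf sum_distrib_left)
  moreover have "(\<Sum>x\<in>F. m x * \<Delta> (\<lambda>z. (u z)\<^sup>2) x) = 0"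
    by (rule sum_laplacian_zero) (use F in auto)
  ultimately have *: "(\<Sum>x\<in>F. m x * (u x)\<^sup>2) + 2 * h * (\<Sum>x\<in>F. m x * \<Gamma> u u x) \<le> C"
    by simp
  have 1: "(\<Sum>x\<in>E. m x * (u x)\<^sup>2) \<le> (\<Sum>x\<in>F. m x * (u x)\<^sup>2)"
    using F by (intro sum_mono2) (auto simp: m_pos less_imp_le)
  have 2: "(\<Sum>x\<in>E. m x * \<Gamma> u u x) \<le> (\<Sum>x\<in>F. m x * \<Gamma> u u x)"
    using F by (intro sum_mono2) (auto simp: m_pos less_imp_le Gamma_nonneg)
  have 3: "0 \<le> (\<Sum>x\<in>F. m x * \<Gamma> u u x)" "0 \<le> (\<Sum>x\<in>F. m x * (u x)\<^sup>2)"
    by (auto intro!: sum_nonneg simp: m_pos less_imp_le Gamma_nonneg)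
  have "0 \<le> 2 * h * (\<Sum>x\<in>F. m x * \<Gamma> u u x)"
    using h 3 by simp
  then show "(\<Sum>x\<in>E. m x * (u x)\<^sup>2) \<le> C"
    using * 1 by linarith
  have "2 * h * (\<Sum>x\<in>E. m x * \<Gamma> u u x) \<le> 2 * h * (\<Sum>x\<in>F. m x * \<Gamma> u u x)"
    using h 2 by simp
  then have "2 * h * (\<Sum>x\<in>E. m x * \<Gamma> u u x) \<le> C"
    using * 3 by linarith
  then show "(\<Sum>x\<in>E. m x * \<Gamma> u u x) \<le> C / (2 * h)"
    using h by (simp add: pos_le_divide_eq mult.commute mult.left_commute)
qed

section \<open>The resolvent of \<open>\<Delta>\<close> on square-summable functions\<close>

text \<open>Separates the diagonal part, so that \<open>f = g - h * \<Delta> g\<close> can be solved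
  for \<open>g x\<close> in terms of the values at neighbours.\<close>

lemma laplacian_degree:
  "\<Delta> f x = (\<Sum>y\<in>nbrs x. w x y * f y) / m x - (\<Sum>y\<in>nbrs x. w x y) / m x * f x"
  by (simp add: laplacian_sum algebra_simps sum_subtractf diff_divide_distrib sum_distrib_left)

lemma nbrs_sym: "y \<in> nbrs x \<longleftrightarrow> x \<in> nbrs y"
  unfolding nbrs_def using w_sym[of x y] by simp

text \<open>The minimal solution is the increasing limit of the Jacobi iterates \<open>u k\<close> for \<open>f\<close> cut off to
  finite sets. They are finitely supported subsolutions, so the energy bound is uniform in \<open>k\<close>.\<close>

lemma resolvent_exists_nonneg:
  assumes f: "\<And>x. 0 \<le> f x" "ell1 (\<lambda>x. (f x)\<^sup>2)" and h: "0 < h"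
  obtains g where "\<And>x. f x = g x - h * \<Delta> g x" "ell1 (\<lambda>x. (g x)\<^sup>2)" "ell1 (\<Gamma> g g)"
proof -
  define S where "S v x = (\<Sum>y\<in>nbrs x. w x y * v y)" for v x
  define D where "D x = (\<Sum>y\<in>nbrs x. w x y) / m x" for x
  \<comment> \<open>Truncation along an enumeration of the vertices keeps every iterate finitely
    supported, while \<open>f' k\<close> increases to \<open>f\<close>.\<close>
  define f' where "f' k x = (if to_nat_on (UNIV :: 'v set) x < k then f x else 0)" for k :: nat and x
  define u where "u = rec_nat (\<lambda>_. 0) (\<lambda>k v x. (f' k x + h / m x * S v x) / (1 + h * D x))"
  have u0: "u 0 = (\<lambda>_. 0)" and uS: "u (Suc k) = (\<lambda>x. (f' k x + h / m x * S (u k) x) / (1 + h * D x))" for k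
    by (simp_all add: u_def)
  have hm: "0 \<le> h / m x" for x
    using h m_pos[of x] by simp
  have D: "0 \<le> D x" for x
    unfolding D_def using m_pos[of x] by (intro divide_nonneg_pos sum_nonneg w_nonneg)
  then have hD: "0 < 1 + h * D x" for x
    using h by (simp add: add_pos_nonneg)
  have S_mono: "S v x \<le> S v' x" if "\<And>y. v y \<le> v' y" for v v' x
    unfolding S_def by (intro sum_mono mult_left_mono that w_nonneg)
  have S0: "S (\<lambda>_. 0) x = 0" for x by (simp add: S_def)
  have f'_mono: "f' k x \<le> f' (Suc k) x" and f'_le: "f' k x \<le> f x" and f'_nonneg: "0 \<le> f' k x" for k x
    using f by (auto simp: f'_def)
  have lap: "\<Delta> v x = S v x / m x - D x * v x" for v x
    unfolding laplacian_degree S_def D_def by simp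
  have mono: "u k x \<le> u (Suc k) x" for k x
  proof (induction k arbitrary: x)
    case 0
    then show ?case
      using f'_nonneg[of 0 x] hD[of x] by (simp add: uS u0 S0)
  next
    case (Suc k)
    have "h / m x * S (u k) x \<le> h / m x * S (u (Suc k)) x"
      by (intro mult_left_mono S_mono Suc hm)
    then have "f' k x + h / m x * S (u k) x \<le> f' (Suc k) x + h / m x * S (u (Suc k)) x"
      using f'_mono[of k x] by simp
    then have "(f' k x + h / m x * S (u k) x) / (1 + h * D x)
        \<le> (f' (Suc k) x + h / m x * S (u (Suc k)) x) / (1 + h * D x)"
      using hD[of x] by (intro divide_right_mono) auto
    then show ?case
      by (simp only: uS)
  qed
  have nonneg: "0 \<le> u k x" for k x
    using lift_Suc_mono_le[of "\<lambda>k. u k x" 0 k] mono by (simp add: u0)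
  have "finite (to_nat_on (UNIV :: 'v set) -` {..<k})" for k
    by (rule finite_vimageI) (auto simp: inj_on_to_nat_on countable_vertices)
  then have fin_f': "finite {x. f' k x \<noteq> 0}" for k
    by (rule finite_subset[rotated]) (auto simp: f'_def split: if_splits)
  have fin: "finite {x. u k x \<noteq> 0}" for k
  proof (induction k)
    case (Suc k)
    have "{x. u (Suc k) x \<noteq> 0} \<subseteq> {x. f' k x \<noteq> 0} \<union> (\<Union>y\<in>{y. u k y \<noteq> 0}. nbrs y)"
    proof
      fix x assume "x \<in> {x. u (Suc k) x \<noteq> 0}"
      then have "f' k x \<noteq> 0 \<or> S (u k) x \<noteq> 0"
        by (auto simp: uS)
      then show "x \<in> {x. f' k x \<noteq> 0} \<union> (\<Union>y\<in>{y. u k y \<noteq> 0}. nbrs y)"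
      proof
        assume "S (u k) x \<noteq> 0"
        then obtain y where "y \<in> nbrs x" "u k y \<noteq> 0"
          unfolding S_def by (metis (no_types, lifting) mult_zero_right sum.neutral)
        then show ?thesis using nbrs_sym by auto
      qed simp
    qed
    then show ?case
      by (rule finite_subset) (use fin_f' Suc finite_nbrs in auto)
  qed (simp add: u0)
  have rec: "u (Suc k) x * (1 + h * D x) = f' k x + h / m x * S (u k) x" for k x
    using hD[of x] by (simp add: uS)
  \<comment> \<open>Since \<open>u j \<le> u (Suc j)\<close>, replacing the old neighbour values in
    the Jacobi equation by the new ones only lowers the left-hand side.\<close>
  have sub: "u k x - h * \<Delta> (u k) x \<le> f x" for k x
  proof (cases k)
    case 0
    then show ?thesis using f by (simp add: u0 lap S0)
  next
    case (Suc j)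
    have "h / m x * S (u j) x \<le> h / m x * S (u (Suc j)) x"
      by (intro mult_left_mono S_mono mono hm)
    then show ?thesis
      using rec[of j x] f'_le[of j x] unfolding Suc lap by (simp add: algebra_simps)
  qed
  obtain C where C: "\<And>F. finite F \<Longrightarrow> (\<Sum>x\<in>F. m x * (f x)\<^sup>2) \<le> C"
    using f(2) unfolding ell1_def by blast
  have bound: "(\<Sum>x\<in>F. m x * (u k x)\<^sup>2) \<le> C" "(\<Sum>x\<in>F. m x * \<Gamma> (u k) (u k) x) \<le> C / (2 * h)"
    if "finite F" for F k
    using subsolution_energy_bound[OF fin nonneg h sub C that] by auto
  have "\<exists>L. (\<lambda>k. u k x) \<longlonglongrightarrow> L" for x
  proof -
    \<comment> \<open>The energy bound on the singleton \<open>{x}\<close>, with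
      \<open>a \<le> 1 + a\<^sup>2\<close>, bounds the increasing sequence of values at
      \<open>x\<close>.\<close>
    have "u k x \<le> 1 + C / m x" for k
    proof -
      have "(u k x)\<^sup>2 \<le> C / m x"
        using bound(1)[of "{x}" k] m_pos[of x] by (simp add: field_simps)
      moreover have "u k x \<le> 1 + (u k x)\<^sup>2"
        using sum_squares_bound[of "u k x" 1] nonneg[of k x] by simp
      ultimately show ?thesis by simp
    qed
    then show ?thesis
      using incseq_convergent[of "\<lambda>k. u k x"] mono by (metis incseq_SucI)
  qed
  then obtain g where g: "\<And>x. (\<lambda>k. u k x) \<longlonglongrightarrow> g x"
    by metis
  show ?thesis
  proof
    show "f x = g x - h * \<Delta> g x" for x
    proof -
      have "(\<lambda>k. u (Suc k) x * (1 + h * D x)) \<longlonglongrightarrow> g x * (1 + h * D x)"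
        by (intro tendsto_intros LIMSEQ_Suc g)
      moreover have "(\<lambda>k. f' k x + h / m x * S (u k) x) \<longlonglongrightarrow> f x + h / m x * S g x"
      proof (intro tendsto_intros)
        have "eventually (\<lambda>k. f' k x = f x) sequentially"
          unfolding f'_def using eventually_gt_at_top[of "to_nat_on UNIV x"] by eventually_elim auto
        then show "(\<lambda>k. f' k x) \<longlonglongrightarrow> f x"
          by (rule tendsto_eventually)
        show "(\<lambda>k. S (u k) x) \<longlonglongrightarrow> S g x"
          unfolding S_def by (intro tendsto_intros g)
      qed
      ultimately have "g x * (1 + h * D x) = f x + h / m x * S g x"
        unfolding rec by (rule LIMSEQ_unique)
      then show ?thesis
        unfolding lap by (simp add: algebra_simps)
    qed
    have "(\<Sum>x\<in>F. m x * (g x)\<^sup>2) \<le> C" if "finite F" for F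
    proof (rule LIMSEQ_le_const2)
      show "(\<lambda>k. \<Sum>x\<in>F. m x * (u k x)\<^sup>2) \<longlonglongrightarrow> (\<Sum>x\<in>F. m x * (g x)\<^sup>2)"
        by (intro tendsto_intros g)
    qed (use bound(1)[OF that] in auto)
    then show "ell1 (\<lambda>x. (g x)\<^sup>2)"
      unfolding ell1_def by blast
    have "(\<Sum>x\<in>F. m x * \<Gamma> g g x) \<le> C / (2 * h)" if "finite F" for F
    proof (rule LIMSEQ_le_const2)
      show "(\<lambda>k. \<Sum>x\<in>F. m x * \<Gamma> (u k) (u k) x) \<longlonglongrightarrow> (\<Sum>x\<in>F. m x * \<Gamma> g g x)"
        unfolding Gamma_sum by (intro tendsto_intros g) (use m_pos in \<open>simp add: less_imp_neq[symmetric]\<close>)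
    qed (use bound(2)[OF that] in auto)
    then show "ell1 (\<Gamma> g g)"
      unfolding ell1_def by blast
  qed
qed

lemma ell1_diff_square:
  assumes "ell1 (\<lambda>x. (f x)\<^sup>2)" "ell1 (\<lambda>x. (g x)\<^sup>2)"
  shows "ell1 (\<lambda>x. (f x - g x)\<^sup>2)"
proof (rule ell1_mono)
  show "ell1 (\<lambda>x. 2 * (f x)\<^sup>2 + 2 * (g x)\<^sup>2)"
    by (intro ell1_add ell1_cmult assms) auto
  show "(f x - g x)\<^sup>2 \<le> 2 * (f x)\<^sup>2 + 2 * (g x)\<^sup>2" for x
    using sum_squares_bound[of "- f x" "g x"] by (simp add: power2_diff)
qed

text \<open>The equation is linear, so the positive and negative parts of \<open>f\<close> are
  treated separately.\<close>

lemma resolvent_exists: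
  assumes f: "ell1 (\<lambda>x. (f x)\<^sup>2)" and h: "0 < h"
  obtains g where "\<And>x. f x = g x - h * \<Delta> g x" "ell1 (\<lambda>x. (g x)\<^sup>2)" "ell1 (\<Gamma> g g)"
proof -
  have p: "ell1 (\<lambda>x. (max (f x) 0)\<^sup>2)" and n: "ell1 (\<lambda>x. (max (- f x) 0)\<^sup>2)"
    by (rule ell1_mono[OF f]; simp add: max_def)+
  obtain g1 where g1: "\<And>x. max (f x) 0 = g1 x - h * \<Delta> g1 x" "ell1 (\<lambda>x. (g1 x)\<^sup>2)" "ell1 (\<Gamma> g1 g1)"
    by (rule resolvent_exists_nonneg[OF _ p h]) auto
  obtain g2 where g2: "\<And>x. max (- f x) 0 = g2 x - h * \<Delta> g2 x" "ell1 (\<lambda>x. (g2 x)\<^sup>2)" "ell1 (\<Gamma> g2 g2)"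
    by (rule resolvent_exists_nonneg[OF _ n h]) auto
  show ?thesis
  proof
    show "f x = (g1 x - g2 x) - h * \<Delta> (\<lambda>x. g1 x - g2 x) x" for x
      unfolding laplacian_diff using g1(1)[of x] g2(1)[of x] by (simp add: algebra_simps max_def split: if_splits)
    show "ell1 (\<lambda>x. (g1 x - g2 x)\<^sup>2)"
      by (intro ell1_diff_square g1 g2)
    show "ell1 (\<Gamma> (\<lambda>x. g1 x - g2 x) (\<lambda>x. g1 x - g2 x))"
    proof (rule ell1_mono[OF _ Gamma_diff_le])
      show "ell1 (\<lambda>x. 2 * \<Gamma> g1 g1 x + 2 * \<Gamma> g2 g2 x)"
        by (intro ell1_add ell1_cmult g1 g2) auto
    qed
  qed
qed

section \<open>The implicit Euler scheme and its decay\<close>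

text \<open>Dependent choice iterates the resolvent. Summability of \<open>\<Gamma>\<close> is
  supplied by the resolvent, hence stated at indices \<open>Suc k\<close>.\<close>

lemma euler_scheme_exists:
  assumes f: "ell1 (\<lambda>x. (f x)\<^sup>2)" and h: "0 < h"
  obtains g where "g 0 = f" "\<And>k x. g k x = g (Suc k) x - h * \<Delta> (g (Suc k)) x"
    "\<And>k. ell1 (\<lambda>x. (g k x)\<^sup>2)" "\<And>k. ell1 (\<Gamma> (g (Suc k)) (g (Suc k)))"
proof -
  have "\<exists>g. \<forall>k. (ell1 (\<lambda>x. (g k x)\<^sup>2) \<and> (k = 0 \<longrightarrow> g k = f)) \<and>
      ((\<forall>x. g k x = g (Suc k) x - h * \<Delta> (g (Suc k)) x) \<and> ell1 (\<Gamma> (g (Suc k)) (g (Suc k))))"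
  proof (rule dependent_nat_choice)
    show "\<exists>g. ell1 (\<lambda>x. (g x)\<^sup>2) \<and> ((0::nat) = 0 \<longrightarrow> g = f)"
      using f by blast
    show "\<exists>g'. (ell1 (\<lambda>x. (g' x)\<^sup>2) \<and> (Suc k = 0 \<longrightarrow> g' = f)) \<and>
        ((\<forall>x. g x = g' x - h * \<Delta> g' x) \<and> ell1 (\<Gamma> g' g'))"
      if "ell1 (\<lambda>x. (g x)\<^sup>2) \<and> (k = 0 \<longrightarrow> g = f)" for g and k :: nat
      using that by (auto intro: resolvent_exists[of g h] simp: h)
  qed
  then show ?thesis
    using that by metis
qed

text \<open>Iterates \<open>euler_step_at_max\<close> with
  \<open>\<phi> k = \<epsilon> + A * (1 - q ^ k)\<close>. The positive \<open>\<epsilon>\<close>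
  bounds the denominator of the loss term, which is then of order \<open>h\<^sup>2\<close>;
  \<open>cond\<close> is the resulting requirement divided by \<open>2 * h\<close>.\<close>

lemma euler_scheme_decay:
  assumes CD: "CD w m K (ereal n)" and nd: "nondegenerate_measure m"
    and pos: "0 < K" "0 < n" "0 < h" "0 < \<epsilon>" "0 < A"
    and cond: "K * (\<epsilon> + A) + 2 * h * K\<^sup>2 * A\<^sup>2 / \<epsilon> \<le> 1 / n"
    and q: "q = 1 / (1 + 2 * h * K)"
    and step: "\<And>k x. g k x = g (Suc k) x - h * \<Delta> (g (Suc k)) x"
    and l2: "\<And>k. ell1 (\<lambda>x. (g k x)\<^sup>2)" and energy: "\<And>k. ell1 (\<Gamma> (g (Suc k)) (g (Suc k)))"
    and init: "\<And>x. \<Gamma> (g 0) (g 0) x + \<epsilon> * (\<Delta> (g 0) x)\<^sup>2 \<le> S"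
  shows "\<Gamma> (g k) (g k) x + (\<epsilon> + A * (1 - q ^ k)) * (\<Delta> (g k) x)\<^sup>2 \<le> q ^ k * S"
proof (induction k arbitrary: x)
  case 0
  show ?case using init by simp
next
  case (Suc k)
  have hK: "0 < h * K" using pos by simp
  have q_pos: "0 < q" and q_le: "q \<le> 1" and q1: "(1 + 2 * h * K) * q = 1"
    unfolding q using hK by (auto simp: field_simps)
  have qk: "0 < q ^ k" "q ^ k \<le> 1" "0 \<le> 1 - q ^ k" for k
    using q_pos q_le by (auto simp: power_le_one)
  define \<phi> where "\<phi> k = \<epsilon> + A * (1 - q ^ k)" for k
  have \<phi>: "\<epsilon> \<le> \<phi> k" for k
    using pos qk[of k] unfolding \<phi>_def by simp
  have diff: "(1 + 2 * h * K) * (\<phi> (Suc k) - \<phi> k) = 2 * h * K * A * q ^ k"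
  proof -
    have "(1 + 2 * h * K) * (\<phi> (Suc k) - \<phi> k) = A * q ^ k * ((1 + 2 * h * K) - (1 + 2 * h * K) * q)"
      by (simp add: \<phi>_def algebra_simps)
    then show ?thesis by (simp add: q1)
  qed
  have diff_eq: "\<phi> (Suc k) - \<phi> k = A * q ^ k * (1 - q)"
    by (simp add: \<phi>_def algebra_simps)
  have diff_nonneg: "0 \<le> \<phi> (Suc k) - \<phi> k"
    unfolding diff_eq using pos qk[of k] q_le by simp
  have "\<phi> (Suc k) - \<phi> k \<le> (1 + 2 * h * K) * (\<phi> (Suc k) - \<phi> k)"
    using mult_right_mono[of 1 "1 + 2 * h * K", OF _ diff_nonneg] hK by (simp add: mult.assoc)
  also have "\<dots> \<le> 2 * h * K * A"
    unfolding diff using pos qk[of k] by (simp add: mult_left_le)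
  finally have "(\<phi> (Suc k) - \<phi> k)\<^sup>2 \<le> (2 * h * K * A)\<^sup>2"
    using diff_nonneg by (intro power_mono)
  then have "(\<phi> (Suc k) - \<phi> k)\<^sup>2 / \<phi> k \<le> (2 * h * K * A)\<^sup>2 / \<epsilon>"
    using \<phi>[of k] pos by (intro frac_le) auto
  also have "\<dots> = 2 * h * (2 * h * K\<^sup>2 * A\<^sup>2 / \<epsilon>)"
    by (simp add: power2_eq_square)
  finally have loss: "(\<phi> (Suc k) - \<phi> k)\<^sup>2 / \<phi> k \<le> 2 * h * (2 * h * K\<^sup>2 * A\<^sup>2 / \<epsilon>)" .
  have "2 * h * (K * (\<epsilon> + A) + 2 * h * K\<^sup>2 * A\<^sup>2 / \<epsilon>) \<le> 2 * h * (1 / n)"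
    using cond pos by (intro mult_left_mono) auto
  \<comment> \<open>The shape of \<open>\<phi>\<close> makes the dependence on \<open>k\<close>
    cancel in the increment, so one \<open>cond\<close> serves every step.\<close>
  moreover have "(1 + 2 * h * K) * \<phi> (Suc k) = \<phi> k + 2 * h * K * (\<epsilon> + A)"
    using diff by (simp add: \<phi>_def algebra_simps)
  ultimately have cond': "(1 + 2 * h * K) * \<phi> (Suc k) + (\<phi> (Suc k) - \<phi> k)\<^sup>2 / \<phi> k \<le> 2 * h / n + \<phi> k"
    using loss by (simp add: algebra_simps)
  define H where "H x = \<Gamma> (g (Suc k)) (g (Suc k)) x + \<phi> (Suc k) * (\<Delta> (g (Suc k)) x)\<^sup>2" for x
  \<comment> \<open>As a difference quotient of square-summable iterates,
    \<open>\<Delta> (g (Suc k))\<close> is square-summable even though \<open>\<Delta>\<close> may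
    be an unbounded operator.\<close>
  have "\<Delta> (g (Suc k)) x = (g (Suc k) x - g k x) / h" for x
    using step[of k x] pos by simp
  then have "ell1 (\<lambda>x. (\<Delta> (g (Suc k)) x)\<^sup>2)"
    using ell1_cmult[OF ell1_diff_square[OF l2[of "Suc k"] l2[of k]], of "1 / h\<^sup>2"]
    by (simp add: power_divide)
  then have "ell1 H"
    unfolding H_def using \<phi>[of "Suc k"] pos by (intro ell1_add energy ell1_cmult) auto
  moreover have "0 \<le> H x" for x
    unfolding H_def using \<phi>[of "Suc k"] pos Gamma_nonneg[of "g (Suc k)" x] by simp
  ultimately obtain x0 where x0: "\<And>y. H y \<le> H x0"
    using ell1_attains_max[OF nd] by blast
  have "(1 + 2 * h * K) * H x0 \<le> \<Gamma> (g k) (g k) x0 + \<phi> k * (\<Delta> (g k) x0)\<^sup>2"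
    unfolding H_def
    by (rule euler_step_at_max[OF CD _ _ _ _ cond' step])
      (use pos \<phi>[of k] diff_nonneg x0 in \<open>auto simp: H_def\<close>)
  also have "\<dots> \<le> q ^ k * S"
    unfolding \<phi>_def by (rule Suc.IH)
  finally have "q * ((1 + 2 * h * K) * H x0) \<le> q * (q ^ k * S)"
    using q_pos by (intro mult_left_mono) auto
  moreover have "q * ((1 + 2 * h * K) * H x0) = H x0"
    using q1 by (simp add: mult.assoc[symmetric] mult.commute[of q])
  ultimately have "H x \<le> q ^ Suc k * S"
    using x0[of x] by simp
  then show ?case
    by (simp add: H_def \<phi>_def)
qed

section \<open>Oscillation of finitely supported functions\<close>

text \<open>Each edge of a path contributes through \<open>Gamma_edge\<close> a constant given by
  \<open>m\<close> and \<open>w\<close>. Since \<open>C\<close> does not depend on \<open>g\<close>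
  or \<open>c\<close>, differences vanish once \<open>\<Gamma>\<close> tends to 0 uniformly.\<close>

lemma connected_oscillation:
  assumes "(\<lambda>u v. 0 < w u v)\<^sup>*\<^sup>* x y"
  shows "\<exists>C. \<forall>g c. (\<forall>z. \<Gamma> g g z \<le> c) \<longrightarrow> (g y - g x)\<^sup>2 \<le> C * c"
  using assms
proof (induction rule: rtranclp_induct)
  case base
  show ?case by (rule exI[of _ 0]) simp
next
  case (step y z)
  obtain C where C: "\<And>g c. (\<forall>z. \<Gamma> g g z \<le> c) \<Longrightarrow> (g y - g x)\<^sup>2 \<le> C * c"
    using step.IH by blast
  have "(g z - g x)\<^sup>2 \<le> (2 * C + 4 * m y / w y z) * c" if g: "\<forall>z. \<Gamma> g g z \<le> c" for g c
  proof -
    have "w y z * (g z - g y)\<^sup>2 \<le> 2 * m y * \<Gamma> g g y"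
      by (rule Gamma_edge)
    also have "\<dots> \<le> 2 * m y * c"
      using g m_pos[of y] by simp
    finally have "(g z - g y)\<^sup>2 \<le> 2 * m y / w y z * c"
      using step.hyps(2) by (simp add: pos_le_divide_eq mult.commute)
    moreover have "(g z - g x)\<^sup>2 \<le> 2 * (g z - g y)\<^sup>2 + 2 * (g y - g x)\<^sup>2"
      using sum_squares_bound[of "g z - g y" "g y - g x"]
        power2_sum[of "g z - g y" "g y - g x"] by simp
    ultimately show ?thesis
      using C[OF g] by (simp add: distrib_right)
  qed
  then show ?case by blast
qed

text \<open>Here \<open>c * (p - 1) = h * sqrt (S / A)\<close> and \<open>r ^ k = sin \<theta>\<^sub>k\<close>, so the increments of the scheme
  telescope by \<open>arcsin_step\<close>.\<close>

lemma oscillation_discrete: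
  assumes CD: "CD w m K (ereal n)" and nd: "nondegenerate_measure m"
    and conn: "(\<lambda>u v. 0 < w u v)\<^sup>*\<^sup>* x y"
    and pos: "0 < K" "0 < n" "0 < h" "0 < \<epsilon>" "0 < A"
    and cond: "K * (\<epsilon> + A) + 2 * h * K\<^sup>2 * A\<^sup>2 / \<epsilon> \<le> 1 / n"
    and fin: "finite {x. f x \<noteq> 0}"
    and init: "\<And>x. \<Gamma> f f x + \<epsilon> * (\<Delta> f x)\<^sup>2 \<le> S"
  shows "f y - f x \<le> sqrt (S / A) * ((sqrt (1 + 2 * h * K) + 1) / (2 * K)) * pi"
proof -
  define p where "p = sqrt (1 + 2 * h * K)"
  define q where "q = 1 / (1 + 2 * h * K)"
  define r where "r = 1 / p"
  have hK: "0 < h * K" using pos by simp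
  have p1: "1 < p" unfolding p_def using pos by simp
  have p2: "p\<^sup>2 = 1 + 2 * h * K"
    unfolding p_def using hK by simp
  have r: "0 < r" "r < 1" "r\<^sup>2 = q" "p * r = 1"
    unfolding r_def q_def p2[symmetric] using p1 by (auto simp: power_divide)
  have rk: "p * r ^ Suc k = r ^ k" "0 < r ^ k" "r ^ k \<le> 1" for k
    using r by (auto simp: mult.assoc[symmetric] power_le_one)
  have qk: "q ^ k = (r ^ k)\<^sup>2" for k
    unfolding r(3)[symmetric] by (simp add: power_mult[symmetric] mult.commute)
  have "\<Gamma> f f x + \<epsilon> * (\<Delta> f x)\<^sup>2 \<ge> 0"
    using pos Gamma_nonneg[of f x] by simp
  then have S: "0 \<le> S" using init[of x] by simp
  have "ell1 (\<lambda>x. (f x)\<^sup>2)"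
    by (rule ell1_finite_support) (use fin in simp)
  then obtain g where g: "g 0 = f" "\<And>k x. g k x = g (Suc k) x - h * \<Delta> (g (Suc k)) x"
    "\<And>k. ell1 (\<lambda>x. (g k x)\<^sup>2)" "\<And>k. ell1 (\<Gamma> (g (Suc k)) (g (Suc k)))"
    using euler_scheme_exists[OF _ pos(3)] by blast
  have decay: "\<Gamma> (g k) (g k) z + (\<epsilon> + A * (1 - q ^ k)) * (\<Delta> (g k) z)\<^sup>2 \<le> q ^ k * S" for k z
    by (rule euler_scheme_decay[where g = g, OF CD nd pos cond q_def g(2-4)]) (use g(1) init in auto)
  have qk1: "0 \<le> 1 - q ^ k" for k
    unfolding qk using rk[of k] by (simp add: power_le_one)
  \<comment> \<open>Only the part \<open>A * (1 - q ^ Suc k)\<close> of the decay estimate is kept,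
    which makes the bound a tangent free of \<open>\<epsilon>\<close>.\<close>
  have speed: "\<bar>\<Delta> (g (Suc k)) z\<bar> \<le> sqrt (S / A) * (r ^ Suc k / sqrt (1 - (r ^ Suc k)\<^sup>2))" for k z
  proof -
    define s where "s = r ^ Suc k"
    have "s < 1" "0 < s"
      unfolding s_def using r by (auto simp: power_Suc_less_one simp del: power_Suc)
    then have s: "0 < 1 - s\<^sup>2" "0 < s"
      by (auto simp: abs_square_less_1)
    have "A * (1 - s\<^sup>2) * (\<Delta> (g (Suc k)) z)\<^sup>2 \<le> (\<epsilon> + A * (1 - s\<^sup>2)) * (\<Delta> (g (Suc k)) z)\<^sup>2"
      using pos by (intro mult_right_mono) auto
    also have "\<dots> \<le> s\<^sup>2 * S"
      using decay[of "Suc k" z] Gamma_nonneg[of "g (Suc k)" z] unfolding qk s_def[symmetric] by simp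
    finally have "(\<Delta> (g (Suc k)) z)\<^sup>2 \<le> S / A * (s\<^sup>2 / (1 - s\<^sup>2))"
      using pos s by (simp add: field_simps)
    then have "sqrt ((\<Delta> (g (Suc k)) z)\<^sup>2) \<le> sqrt (S / A * (s\<^sup>2 / (1 - s\<^sup>2)))"
      by (rule real_sqrt_le_mono)
    then show ?thesis
      using s by (simp add: real_sqrt_mult real_sqrt_divide s_def)
  qed
  define c where "c = h * sqrt (S / A) / (p - 1)"
  have c: "0 \<le> c" unfolding c_def using pos S p1 by simp
  \<comment> \<open>The implicit scheme moves by \<open>\<Delta> (g (Suc N))\<close>, so the tangent
    bound is used only at \<open>r ^ Suc N < 1\<close>; at \<open>r ^ 0 = 1\<close> it would be
    singular.\<close>
  have total: "\<bar>g N z - f z\<bar> \<le> c * (arcsin 1 - arcsin (r ^ N))" for N z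
  proof (induction N)
    case 0
    then show ?case by (simp add: g)
  next
    case (Suc N)
    have "\<bar>g (Suc N) z - g N z\<bar> = h * \<bar>\<Delta> (g (Suc N)) z\<bar>"
      using g(2)[of N z] pos by (simp add: abs_mult)
    also have "\<dots> \<le> h * (sqrt (S / A) * (r ^ Suc N / sqrt (1 - (r ^ Suc N)\<^sup>2)))"
      using pos by (intro mult_left_mono speed) auto
    also have "\<dots> = c * ((p - 1) * (r ^ Suc N / sqrt (1 - (r ^ Suc N)\<^sup>2)))"
      unfolding c_def using p1 by simp
    also have "\<dots> \<le> c * (arcsin (p * r ^ Suc N) - arcsin (r ^ Suc N))"
      by (intro mult_left_mono arcsin_step c) (use rk p1 in \<open>auto simp del: power_Suc\<close>)
    also have "\<dots> = c * (arcsin (r ^ N) - arcsin (r ^ Suc N))"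
      by (simp only: rk)
    finally have "\<bar>g (Suc N) z - g N z\<bar> \<le> c * (arcsin (r ^ N) - arcsin (r ^ Suc N))" .
    then show ?case
      using Suc unfolding right_diff_distrib by linarith
  qed
  have half: "\<bar>g N z - f z\<bar> \<le> c * (pi / 2)" for N z
  proof -
    have "0 \<le> arcsin (r ^ N)"
      using rk[of N] arcsin_le_arcsin[of 0 "r ^ N"] by simp
    then have "c * (arcsin 1 - arcsin (r ^ N)) \<le> c * (pi / 2)"
      by (intro mult_left_mono c) simp
    then show ?thesis using total[of N z] by linarith
  qed
  obtain C where C: "\<And>g c. (\<forall>z. \<Gamma> g g z \<le> c) \<Longrightarrow> (g y - g x)\<^sup>2 \<le> C * c"
    using connected_oscillation[OF conn] by blast
  have osc: "(g N y - g N x)\<^sup>2 \<le> C * (q ^ N * S)" for N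
  proof (rule C, intro allI)
    fix z
    have "0 \<le> (\<epsilon> + A * (1 - q ^ N)) * (\<Delta> (g N) z)\<^sup>2"
      using pos qk1[of N] by simp
    then show "\<Gamma> (g N) (g N) z \<le> q ^ N * S"
      using decay[of N z] by simp
  qed
  \<comment> \<open>Compare \<open>f\<close> with \<open>g N\<close> at both endpoints, each at cost
    \<open>c * (pi / 2)\<close>, and \<open>g N y\<close> with \<open>g N x\<close> along the
    path.\<close>
  have "f y - f x \<le> c * pi + sqrt (C * (q ^ N * S))" for N
  proof -
    have "\<bar>g N y - g N x\<bar> \<le> sqrt (C * (q ^ N * S))"
      using real_sqrt_le_mono[OF osc[of N]] by simp
    then show ?thesis
      using half[of N x] half[of N y] by linarith
  qed
  moreover have "(\<lambda>N. c * pi + sqrt (C * (q ^ N * S))) \<longlonglongrightarrow> c * pi + sqrt (C * (0 * S))"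
    by (intro tendsto_intros LIMSEQ_power_zero) (use pos in \<open>auto simp: q_def field_simps add_pos_pos\<close>)
  ultimately have "f y - f x \<le> c * pi + sqrt (C * (0 * S))"
    by (intro LIMSEQ_le_const) auto
  \<comment> \<open>Using \<open>p\<^sup>2 - 1 = 2 * h * K\<close> removes a quotient that would
    become \<open>0 / 0\<close> as \<open>h\<close> tends to 0.\<close>
  moreover have "h / (p - 1) = (p + 1) / (2 * K)"
    using p1 p2 pos by (simp add: field_simps power2_eq_square)
  then have "c = sqrt (S / A) * ((p + 1) / (2 * K))"
    unfolding c_def by (metis mult.commute times_divide_eq_right)
  ultimately show ?thesis
    by (simp add: p_def)
qed

text \<open>The parameters of \<open>oscillation_discrete\<close> are removed in turn:
  \<open>h\<close> to 0, \<open>\<epsilon>\<close> to 0, then \<open>A\<close> up to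
  \<open>1 / (K * n)\<close>. The step size goes first because \<open>cond\<close> divides by
  \<open>\<epsilon>\<close>; strict inequalities leave room for small positive values.\<close>

lemma oscillation_finite_support:
  assumes CD: "CD w m K (ereal n)" and nd: "nondegenerate_measure m"
    and conn: "(\<lambda>u v. 0 < w u v)\<^sup>*\<^sup>* x y"
    and pos: "0 < K" "0 < n"
    and fin: "finite {x. f x \<noteq> 0}"
    and init: "\<And>x. \<Gamma> f f x \<le> 1"
  shows "f y - f x \<le> pi * sqrt (n / K)"
proof -
  \<comment> \<open>\<open>\<Delta> f\<close> vanishes off a finite set, so its square has a uniform
    bound \<open>C\<close>.\<close>
  have "finite ((\<lambda>z. (\<Delta> f z)\<^sup>2) ` UNIV)"
  proof -
    obtain F where F: "finite F" "\<And>x. f x \<noteq> 0 \<Longrightarrow> x \<in> F \<and> nbrs x \<subseteq> F"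
      using finite_support_hull[OF fin finite.emptyI] by metis
    have "\<Delta> f z = 0" if "z \<notin> F" for z
    proof -
      have "f z = 0"
        using F(2)[of z] that by auto
      moreover have "f y = 0" if "y \<in> nbrs z" for y
        using F(2)[of y] that \<open>z \<notin> F\<close> nbrs_sym[of y z] by auto
      ultimately show ?thesis by (simp add: laplacian_sum)
    qed
    then have "(\<Delta> f z)\<^sup>2 \<in> insert 0 ((\<lambda>z. (\<Delta> f z)\<^sup>2) ` F)" for z
      by (cases "z \<in> F") auto
    then have "(\<lambda>z. (\<Delta> f z)\<^sup>2) ` UNIV \<subseteq> insert 0 ((\<lambda>z. (\<Delta> f z)\<^sup>2) ` F)"
      by blast
    then show ?thesis
      by (rule finite_subset) (use F(1) in simp)
  qed
  then have "bdd_above ((\<lambda>z. (\<Delta> f z)\<^sup>2) ` UNIV)"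
    by (rule bdd_above_finite)
  then obtain C where C: "\<And>z. (\<Delta> f z)\<^sup>2 \<le> C"
    by (auto simp: bdd_above_def)
  have 1: "f y - f x \<le> sqrt ((1 + \<epsilon> * C) / A) * ((sqrt (1 + 2 * 0 * K) + 1) / (2 * K)) * pi"
    if A: "0 < \<epsilon>" "0 < A" "K * (\<epsilon> + A) < 1 / n" for \<epsilon> A
  proof (rule tendsto_lowerbound)
    show "((\<lambda>h. sqrt ((1 + \<epsilon> * C) / A) * ((sqrt (1 + 2 * h * K) + 1) / (2 * K)) * pi) \<longlongrightarrow>
        sqrt ((1 + \<epsilon> * C) / A) * ((sqrt (1 + 2 * 0 * K) + 1) / (2 * K)) * pi) (at_right 0)"
      by (intro tendsto_intros) (use pos in auto)
    have "((\<lambda>h. K * (\<epsilon> + A) + 2 * h * K\<^sup>2 * A\<^sup>2 / \<epsilon>) \<longlongrightarrow> K * (\<epsilon> + A) + 2 * 0 * K\<^sup>2 * A\<^sup>2 / \<epsilon>) (at_right 0)"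
      by (intro tendsto_intros) (use A in auto)
    then have "eventually (\<lambda>h. K * (\<epsilon> + A) + 2 * h * K\<^sup>2 * A\<^sup>2 / \<epsilon> < 1 / n) (at_right 0)"
      by (rule order_tendstoD) (use A in simp)
    moreover have "eventually (\<lambda>h. (0::real) < h) (at_right 0)"
      by (simp add: eventually_at_right_less)
    ultimately show "eventually (\<lambda>h. f y - f x \<le>
        sqrt ((1 + \<epsilon> * C) / A) * ((sqrt (1 + 2 * h * K) + 1) / (2 * K)) * pi) (at_right 0)"
    proof eventually_elim
      case (elim h)
      have "\<Gamma> f f z + \<epsilon> * (\<Delta> f z)\<^sup>2 \<le> 1 + \<epsilon> * C" for z
        using A by (intro add_mono init mult_left_mono C) auto
      then show ?case
        using elim by (intro oscillation_discrete[OF CD nd conn pos _ A(1,2) _ fin]) auto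
    qed
  qed simp
  have 2: "f y - f x \<le> sqrt ((1 + 0 * C) / A) * (1 / K) * pi" if A: "0 < A" "K * A < 1 / n" for A
  proof (rule tendsto_lowerbound)
    show "((\<lambda>\<epsilon>. sqrt ((1 + \<epsilon> * C) / A) * (1 / K) * pi) \<longlongrightarrow> sqrt ((1 + 0 * C) / A) * (1 / K) * pi) (at_right 0)"
      by (intro tendsto_intros) (use A in auto)
    have "((\<lambda>\<epsilon>. K * (\<epsilon> + A)) \<longlongrightarrow> K * (0 + A)) (at_right 0)"
      by (intro tendsto_intros)
    then have "eventually (\<lambda>\<epsilon>. K * (\<epsilon> + A) < 1 / n) (at_right 0)"
      by (rule order_tendstoD) (use A in simp)
    moreover have "eventually (\<lambda>\<epsilon>. (0::real) < \<epsilon>) (at_right 0)"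
      by (simp add: eventually_at_right_less)
    ultimately show "eventually (\<lambda>\<epsilon>. f y - f x \<le> sqrt ((1 + \<epsilon> * C) / A) * (1 / K) * pi) (at_right 0)"
      by eventually_elim (use 1 A in auto)
  qed simp
  have A0: "0 < 1 / (K * n)" using pos by simp
  \<comment> \<open>Approaching from the left keeps \<open>K * A < 1 / n\<close>.\<close>
  have "f y - f x \<le> sqrt (1 / (1 / (K * n))) * (1 / K) * pi"
  proof (rule tendsto_lowerbound)
    show "((\<lambda>A. sqrt (1 / A) * (1 / K) * pi) \<longlongrightarrow> sqrt (1 / (1 / (K * n))) * (1 / K) * pi)
        (at_left (1 / (K * n)))"
      by (intro tendsto_intros) (use A0 in auto)
    have "eventually (\<lambda>A. A \<in> {0<..<1 / (K * n)}) (at_left (1 / (K * n)))"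
      using A0 by (rule eventually_at_left_real)
    then show "eventually (\<lambda>A. f y - f x \<le> sqrt (1 / A) * (1 / K) * pi) (at_left (1 / (K * n)))"
    proof eventually_elim
      case (elim A)
      then have "K * A < 1 / n" using pos by (simp add: field_simps)
      then show ?case using 2[of A] elim by simp
    qed
  qed simp
  also have "\<dots> = pi * sqrt (n / K)"
    using pos by (simp add: real_sqrt_mult real_sqrt_divide field_simps)
  finally show ?thesis .
qed

section \<open>Cutting off general functions\<close>

text \<open>Young's inequality with weight \<open>t\<close>: \<open>\<Gamma> f f\<close> keeps a
  factor near 1 for small \<open>t\<close>, and the large factor \<open>1 + 1 / t\<close> falls on
  \<open>\<Gamma> g g\<close>, which is small when \<open>g\<close> is a cutoff.\<close>

lemma Gamma_mult_le:
  assumes f: "\<And>y. 0 \<le> f y \<and> f y \<le> D" and g: "\<And>y. 0 \<le> g y \<and> g y \<le> 1" and t: "0 < t"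
  shows "\<Gamma> (\<lambda>z. f z * g z) (\<lambda>z. f z * g z) x \<le> (1 + t) * \<Gamma> f f x + (1 + 1 / t) * D\<^sup>2 * \<Gamma> g g x"
proof -
  have "w x y * ((f y * g y - f x * g x) * (f y * g y - f x * g x)) \<le>
    (1 + t) * (w x y * ((f y - f x) * (f y - f x))) + (1 + 1 / t) * D\<^sup>2 * (w x y * ((g y - g x) * (g y - g x)))" for y
  proof -
    define a where "a = g y * (f y - f x)"
    define b where "b = f x * (g y - g x)"
    have "0 \<le> (t * a - b)\<^sup>2 / t"
      using t by simp
    then have "2 * (a * b) \<le> t * a\<^sup>2 + b\<^sup>2 / t"
      using t by (simp add: field_simps power2_eq_square)
    then have "(a + b)\<^sup>2 \<le> (1 + t) * a\<^sup>2 + (1 + 1 / t) * b\<^sup>2"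
      by (simp add: power2_sum algebra_simps)
    also have "\<dots> \<le> (1 + t) * (f y - f x)\<^sup>2 + (1 + 1 / t) * (D\<^sup>2 * (g y - g x)\<^sup>2)"
    proof -
      have "(g y)\<^sup>2 \<le> 1" "(f x)\<^sup>2 \<le> D\<^sup>2"
        using f[of x] g[of y] by (auto simp: power_le_one intro: power_mono)
      then have "a\<^sup>2 \<le> 1 * (f y - f x)\<^sup>2" "b\<^sup>2 \<le> D\<^sup>2 * (g y - g x)\<^sup>2"
        unfolding a_def b_def power_mult_distrib by (intro mult_right_mono; simp)+
      then show ?thesis
        using t by (intro add_mono mult_left_mono) auto
    qed
    also have "a + b = f y * g y - f x * g x"
      by (simp add: a_def b_def algebra_simps)
    finally have "w x y * (f y * g y - f x * g x)\<^sup>2 \<le>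
        w x y * ((1 + t) * (f y - f x)\<^sup>2 + (1 + 1 / t) * (D\<^sup>2 * (g y - g x)\<^sup>2))"
      by (intro mult_left_mono w_nonneg)
    then show ?thesis
      by (simp add: power2_eq_square algebra_simps)
  qed
  then have "(\<Sum>y\<in>nbrs x. w x y * ((f y * g y - f x * g x) * (f y * g y - f x * g x))) \<le>
      (1 + t) * (\<Sum>y\<in>nbrs x. w x y * ((f y - f x) * (f y - f x)))
      + (1 + 1 / t) * D\<^sup>2 * (\<Sum>y\<in>nbrs x. w x y * ((g y - g x) * (g y - g x)))"
    unfolding sum_distrib_left sum.distrib[symmetric] by (rule sum_mono)
  then show ?thesis
    unfolding Gamma_sum using m_pos[of x]
    by (simp add: divide_right_mono add_divide_distrib[symmetric])
qed

text \<open>Truncate \<open>f\<close>, multiply by a cutoff and rescale to reach finite support with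
  \<open>\<Gamma> \<le> 1\<close>; then let \<open>k\<close> tend to infinity and \<open>t\<close>
  to 0.\<close>

lemma oscillation:
  assumes CD: "CD w m K (ereal n)" and nd: "nondegenerate_measure m"
    and conn: "(\<lambda>u v. 0 < w u v)\<^sup>*\<^sup>* x y" and complete: "complete_graph w m"
    and pos: "0 < K" "0 < n"
    and f: "\<And>x. \<Gamma> f f x \<le> 1"
  shows "f y - f x \<le> pi * sqrt (n / K)"
proof (cases "f y \<le> f x")
  case True
  moreover have "0 \<le> pi * sqrt (n / K)" using pos by simp
  ultimately show ?thesis by linarith
next
  case False
  define D where "D = f y - f x"
  have D: "0 < D" using False by (simp add: D_def)
  \<comment> \<open>Truncation gives the bounds that \<open>Gamma_mult_le\<close> needs while
    preserving the difference between \<open>x\<close> and \<open>y\<close>.\<close>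
  define F where "F z = min (max (f z - f x) 0) D" for z
  have F: "0 \<le> F z \<and> F z \<le> D" "F x = 0" "F y = D" for z
    using D by (auto simp: F_def D_def)
  have "\<Gamma> F F z \<le> \<Gamma> f f z" for z
    by (rule Gamma_mono) (auto simp: F_def)
  then have GF: "\<Gamma> F F z \<le> 1" for z
    using f order_trans by blast
  obtain \<eta> where \<eta>: "\<And>k. 1 \<le> k \<Longrightarrow> finite {x. \<eta> k x \<noteq> 0}" "\<And>x. (\<lambda>k. \<eta> k x) \<longlonglongrightarrow> (1::real)"
      "\<And>k x. 1 \<le> k \<Longrightarrow> \<Gamma> (\<eta> k) (\<eta> k) x \<le> 1 / real k"
    using complete unfolding complete_graph_def by blast
  \<comment> \<open>Clamping forces values in \<open>[0, 1]\<close> without raising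
    \<open>\<Gamma>\<close> or enlarging the support.\<close>
  define \<xi> where "\<xi> k z = min (max (\<eta> k z) 0) 1" for k z
  have \<xi>: "0 \<le> \<xi> k z \<and> \<xi> k z \<le> 1" for k z
    by (auto simp: \<xi>_def)
  have \<xi>_lim: "(\<lambda>k. \<xi> k y) \<longlonglongrightarrow> min (max 1 0) 1"
    unfolding \<xi>_def by (intro tendsto_intros \<eta>)
  have bound: "D * \<xi> k y \<le> pi * sqrt (n / K) * sqrt (1 + t + (1 + 1 / t) * D\<^sup>2 * (1 / real k))"
    if k: "1 \<le> k" and t: "0 < t" for k t
  proof -
    define M where "M = 1 + t + (1 + 1 / t) * D\<^sup>2 * (1 / real k)"
    have M: "0 < M" unfolding M_def using t k by (simp add: add_pos_nonneg)
    have "\<Gamma> (\<xi> k) (\<xi> k) z \<le> \<Gamma> (\<eta> k) (\<eta> k) z" for z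
      by (rule Gamma_mono) (auto simp: \<xi>_def)
    then have G\<xi>: "\<Gamma> (\<xi> k) (\<xi> k) z \<le> 1 / real k" for z
      using \<eta>(3)[OF k] order_trans by blast
    define u where "u z = F z * \<xi> k z" for z
    have Gu: "\<Gamma> u u z \<le> M" for z
    proof -
      have "\<Gamma> u u z \<le> (1 + t) * \<Gamma> F F z + (1 + 1 / t) * D\<^sup>2 * \<Gamma> (\<xi> k) (\<xi> k) z"
        unfolding u_def by (rule Gamma_mult_le[OF F(1) \<xi> t])
      also have "\<dots> \<le> (1 + t) * 1 + (1 + 1 / t) * D\<^sup>2 * (1 / real k)"
        using t by (intro add_mono mult_left_mono GF G\<xi>) auto
      finally show ?thesis by (simp add: M_def)
    qed
    define v where "v z = 1 / sqrt M * u z" for z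
    have "v y - v x \<le> pi * sqrt (n / K)"
    proof (rule oscillation_finite_support[OF CD nd conn pos])
      show "finite {x. v x \<noteq> 0}"
        by (rule finite_subset[OF _ \<eta>(1)[OF k]]) (auto simp: v_def u_def \<xi>_def)
      have "\<Gamma> v v z = \<Gamma> u u z / M" for z
        unfolding v_def Gamma_cmult using M by (simp add: power_divide)
      then show "\<Gamma> v v z \<le> 1" for z
        using Gu[of z] M by simp
    qed
    moreover have "v y - v x = D * \<xi> k y / sqrt M"
      by (simp add: v_def u_def F)
    ultimately show ?thesis
      using M unfolding M_def[symmetric] by (simp add: field_simps)
  qed
  \<comment> \<open>Here \<open>t\<close> stays fixed while \<open>k\<close> grows, because the
    error carries the factor \<open>1 + 1 / t\<close>.\<close>
  have "D * min (max 1 0) 1 \<le> pi * sqrt (n / K) * sqrt (1 + t + (1 + 1 / t) * D\<^sup>2 * 0)" if t: "0 < t" for t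
  proof (rule LIMSEQ_le)
    show "(\<lambda>k. D * \<xi> k y) \<longlonglongrightarrow> D * min (max 1 0) 1"
      by (intro tendsto_intros \<xi>_lim)
    show "(\<lambda>k. pi * sqrt (n / K) * sqrt (1 + t + (1 + 1 / t) * D\<^sup>2 * (1 / real k)))
        \<longlonglongrightarrow> pi * sqrt (n / K) * sqrt (1 + t + (1 + 1 / t) * D\<^sup>2 * 0)"
      by (intro tendsto_intros lim_const_over_n)
    show "\<exists>N. \<forall>k\<ge>N. D * \<xi> k y \<le> pi * sqrt (n / K) * sqrt (1 + t + (1 + 1 / t) * D\<^sup>2 * (1 / real k))"
      using bound t by blast
  qed
  then have t: "D \<le> pi * sqrt (n / K) * sqrt (1 + t)" if "0 < t" for t
    using that by simp
  have "D \<le> pi * sqrt (n / K) * sqrt (1 + 0)"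
  proof (rule tendsto_lowerbound)
    show "((\<lambda>t. pi * sqrt (n / K) * sqrt (1 + t)) \<longlongrightarrow> pi * sqrt (n / K) * sqrt (1 + 0)) (at_right 0)"
      by (intro tendsto_intros)
    have "eventually (\<lambda>t. (0::real) < t) (at_right 0)"
      by (simp add: eventually_at_right_less)
    then show "eventually (\<lambda>t. D \<le> pi * sqrt (n / K) * sqrt (1 + t)) (at_right 0)"
      by eventually_elim (rule t)
  qed simp
  then show ?thesis
    by (simp add: D_def)
qed

end

theorem theorem2p4:
  fixes w :: "'v \<Rightarrow> 'v \<Rightarrow> real" and m :: "'v \<Rightarrow> real" and K n :: real
  assumes "weighted_graph w m"
    and "connected_graph w"
    and "complete_graph w m"
    and "locally_finite_graph w"
    and "nondegenerate_measure m"
    and "0 < K" and "0 < n"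
    and "CD w m K (ereal n)"
  shows "resistance_diameter w m \<le> ereal (pi * sqrt (n / K))"
proof -
  interpret lf_graph w m
    using assms by unfold_locales
  have "ereal (f y - f x) \<le> ereal (pi * sqrt (n / K))"
    if f: "sup_norm (\<Gamma> f f) \<le> 1" for f x y
  proof -
    have "ereal \<bar>\<Gamma> f f z\<bar> \<le> 1" for z
      using f unfolding sup_norm_def by (auto simp: SUP_le_iff)
    then have "\<Gamma> f f z \<le> 1" for z
      by (metis abs_le_D1 ereal_less_eq(3) one_ereal_def)
    then show ?thesis
      using oscillation[OF assms(8,5) _ assms(3,6,7)] assms(2)
      by (simp add: connected_graph_def)
  qed
  then show ?thesis
    unfolding resistance_diameter_def resistance_metric_def by (auto intro!: SUP_least)
qed

end
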